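(* For a nontrivial Puiseux monoid $M$ and a field $F$, the following conditions are equivalent: (1) $F[M]$ is a Euclidean domain; (2) $F[M]$ is a PID; (3) $F[M]$ is a UFD; (4) $F[M]$ is an HFD; (5) $M \cong (\mathbb{N}_0,+)$; (6) $F[M]$ is a Dedekind domain.
   Context: $\mathbb{N}_0$ denotes the set of nonnegative integers. A Puiseux monoid is an additive submonoid of $(\mathbb{Q}_{\ge 0},+)$; it is nontrivial if it is not $\{0\}$. The symbol $\cong$ in (5) means isomorphism of monoids. For a field $F$ and a Puiseux monoid $M$, the monoid algebra $F[M]$ is the set of all maps $f\colon M\to F$ with finite support, written as polynomial expressions $f = \sum_{s\in M} f(s)X^s$, with addition and multiplication as for polynomials (so $X^sX^t = X^{s+t}$); it is an integral domain. An integral domain is half-factorial (an HFD) if every nonzero nonunit element is a product of irreducible elements and any two factorizations of the same nonzero nonunit element into irreducibles have the same number of irreducible factors (counting repetitions). *)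

theory Defs
  imports "HOL-Algebra.Algebra"
begin

section \<open>Puiseux monoids\<close>

definition nonneg_rat_monoid :: "rat monoid" where
  "nonneg_rat_monoid = \<lparr>carrier = {q. 0 \<le> q}, monoid.mult = (+), one = 0\<rparr>"

definition nat_add_monoid :: "nat monoid" where
  "nat_add_monoid = \<lparr>carrier = UNIV, monoid.mult = (+), one = 0\<rparr>"

definition puiseux_monoid :: "rat set \<Rightarrow> bool" where
  "puiseux_monoid M \<longleftrightarrow> submonoid M nonneg_rat_monoid"

abbreviation monoid_of :: "rat set \<Rightarrow> rat monoid" where
  "monoid_of M \<equiv> nonneg_rat_monoid\<lparr>carrier := M\<rparr>"


section \<open>Monoid algebras\<close>

text \<open>
  A map from \<open>carrier G\<close> to \<open>carrier F\<close> is represented by its extension by zero to the whole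
  underlying type, so that equal maps are equal as HOL functions.
\<close>

definition supp :: "('f, 'b) ring_scheme \<Rightarrow> ('m \<Rightarrow> 'f) \<Rightarrow> 'm set" where
  "supp F f = {s. f s \<noteq> \<zero>\<^bsub>F\<^esub>}"

definition monoid_algebra ::
    "('f, 'b) ring_scheme \<Rightarrow> ('m, 'c) monoid_scheme \<Rightarrow> ('m \<Rightarrow> 'f) ring" where
  "monoid_algebra F G =
     \<lparr>carrier = {f. range f \<subseteq> carrier F \<and> supp F f \<subseteq> carrier G \<and> finite (supp F f)},
      monoid.mult = (\<lambda>f g s. \<Oplus>\<^bsub>F\<^esub>p\<in>{p \<in> supp F f \<times> supp F g. fst p \<otimes>\<^bsub>G\<^esub> snd p = s}.
                         f (fst p) \<otimes>\<^bsub>F\<^esub> g (snd p)),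
      one = (\<lambda>s. if s = \<one>\<^bsub>G\<^esub> then \<one>\<^bsub>F\<^esub> else \<zero>\<^bsub>F\<^esub>),
      ring.zero = (\<lambda>s. \<zero>\<^bsub>F\<^esub>),
      ring.add = (\<lambda>f g s. f s \<oplus>\<^bsub>F\<^esub> g s)\<rparr>"


section \<open>Half-factorial domains\<close>

locale half_factorial_domain = domain +
  assumes factorization_exists:
    "\<lbrakk>a \<in> carrier R - {\<zero>}; a \<notin> Units R\<rbrakk>
       \<Longrightarrow> \<exists>fs. set fs \<subseteq> carrier (mult_of R) \<and> factors (mult_of R) fs a"
  and factorization_length_unique:
    "\<lbrakk>a \<in> carrier R - {\<zero>}; a \<notin> Units R;
      set fs \<subseteq> carrier (mult_of R); factors (mult_of R) fs a;
      set gs \<subseteq> carrier (mult_of R); factors (mult_of R) gs a\<rbrakk>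
       \<Longrightarrow> length fs = length gs"


section \<open>The field of fractions\<close>

definition frac_rel :: "('a, 'b) ring_scheme \<Rightarrow> (('a \<times> 'a) \<times> ('a \<times> 'a)) set" where
  "frac_rel R = {((a, b), (c, d)).
     a \<in> carrier R \<and> b \<in> carrier R - {\<zero>\<^bsub>R\<^esub>} \<and> c \<in> carrier R \<and> d \<in> carrier R - {\<zero>\<^bsub>R\<^esub>} \<and>
     a \<otimes>\<^bsub>R\<^esub> d = c \<otimes>\<^bsub>R\<^esub> b}"

definition fraction :: "('a, 'b) ring_scheme \<Rightarrow> 'a \<Rightarrow> 'a \<Rightarrow> ('a \<times> 'a) set" where
  "fraction R a b = frac_rel R `` {(a, b)}"

definition fraction_field :: "('a, 'b) ring_scheme \<Rightarrow> ('a \<times> 'a) set ring" where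
  "fraction_field R =
     \<lparr>carrier = {fraction R a b |a b. a \<in> carrier R \<and> b \<in> carrier R - {\<zero>\<^bsub>R\<^esub>}},
      monoid.mult = (\<lambda>x y. \<Union>(a, b)\<in>x. \<Union>(c, d)\<in>y. fraction R (a \<otimes>\<^bsub>R\<^esub> c) (b \<otimes>\<^bsub>R\<^esub> d)),
      one = fraction R \<one>\<^bsub>R\<^esub> \<one>\<^bsub>R\<^esub>,
      ring.zero = fraction R \<zero>\<^bsub>R\<^esub> \<one>\<^bsub>R\<^esub>,
      ring.add = (\<lambda>x y. \<Union>(a, b)\<in>x. \<Union>(c, d)\<in>y.
                fraction R ((a \<otimes>\<^bsub>R\<^esub> d) \<oplus>\<^bsub>R\<^esub> (c \<otimes>\<^bsub>R\<^esub> b)) (b \<otimes>\<^bsub>R\<^esub> d))\<rparr>"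

context domain
begin

lemma frac_eq_iff:
  assumes "a \<in> carrier R" "b \<in> carrier R - {\<zero>}" "c \<in> carrier R" "d \<in> carrier R - {\<zero>}"
  shows "fraction R a b = fraction R c d \<longleftrightarrow> a \<otimes> d = c \<otimes> b"
proof
  assume "fraction R a b = fraction R c d"
  moreover have "(c, d) \<in> fraction R c d"
    using assms by (simp add: fraction_def frac_rel_def)
  ultimately show "a \<otimes> d = c \<otimes> b"
    by (auto simp: fraction_def frac_rel_def)
next
  have *: "(x, y) \<in> fraction R c d"
    if e: "a \<otimes> d = c \<otimes> b" and m: "(x, y) \<in> fraction R a b"
      and C: "a \<in> carrier R" "b \<in> carrier R - {\<zero>}" "c \<in> carrier R" "d \<in> carrier R - {\<zero>}"
    for a b c d x y
  proof -
    have xy: "x \<in> carrier R" "y \<in> carrier R - {\<zero>}" "a \<otimes> y = x \<otimes> b"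
      using m by (auto simp: fraction_def frac_rel_def)
    have "b \<otimes> (c \<otimes> y) = (c \<otimes> b) \<otimes> y"
      using C xy(1,2) by (simp add: m_ac)
    also have "\<dots> = (a \<otimes> d) \<otimes> y"
      by (simp only: e)
    also have "\<dots> = (a \<otimes> y) \<otimes> d"
      using C xy(1,2) by (simp add: m_ac)
    also have "\<dots> = (x \<otimes> b) \<otimes> d"
      by (simp only: xy(3))
    also have "\<dots> = b \<otimes> (x \<otimes> d)"
      using C xy(1,2) by (simp add: m_ac)
    finally have "c \<otimes> y = x \<otimes> d"
      using C xy m_lcancel[of b "c \<otimes> y" "x \<otimes> d"] by simp
    then show ?thesis
      using C xy by (simp add: fraction_def frac_rel_def)
  qed
  assume e: "a \<otimes> d = c \<otimes> b"
  show "fraction R a b = fraction R c d"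
    using *[OF e _ assms] *[OF e[symmetric] _ assms(3,4,1,2)] by auto
qed

lemma frac_UN:
  assumes ab: "a \<in> carrier R" "b \<in> carrier R - {\<zero>}"
    and const: "\<And>x y. \<lbrakk>x \<in> carrier R; y \<in> carrier R - {\<zero>}; a \<otimes> y = x \<otimes> b\<rbrakk> \<Longrightarrow> h (x, y) = h (a, b)"
  shows "(\<Union>p\<in>fraction R a b. h p) = h (a, b)"
proof -
  have "(a, b) \<in> fraction R a b"
    using ab by (simp add: fraction_def frac_rel_def)
  moreover have "h p = h (a, b)" if "p \<in> fraction R a b" for p
  proof -
    obtain x y where p: "p = (x, y)"
      by (cases p)
    have "x \<in> carrier R" "y \<in> carrier R - {\<zero>}" "a \<otimes> y = x \<otimes> b"
      using that by (simp_all add: p fraction_def frac_rel_def)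
    then show ?thesis
      unfolding p by (rule const)
  qed
  ultimately show ?thesis
    by blast
qed

lemma frac_mult:
  assumes "a \<in> carrier R" "b \<in> carrier R - {\<zero>}" "c \<in> carrier R" "d \<in> carrier R - {\<zero>}"
  shows "fraction R a b \<otimes>\<^bsub>fraction_field R\<^esub> fraction R c d = fraction R (a \<otimes> c) (b \<otimes> d)"
proof -
  have inner: "(\<Union>q\<in>fraction R c d. case q of (c, d) \<Rightarrow> fraction R (x \<otimes> c) (y \<otimes> d))
      = fraction R (x \<otimes> c) (y \<otimes> d)" if "x \<in> carrier R" "y \<in> carrier R - {\<zero>}" for x y
  proof (subst frac_UN[OF assms(3,4)])
    fix u v assume *: "u \<in> carrier R" "v \<in> carrier R - {\<zero>}" "c \<otimes> v = u \<otimes> d"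
    have "x \<otimes> u \<otimes> (y \<otimes> d) = (x \<otimes> y) \<otimes> (u \<otimes> d)"
      using *(1,2) that assms by (simp add: m_ac)
    also have "\<dots> = (x \<otimes> y) \<otimes> (c \<otimes> v)"
      by (simp only: *(3))
    also have "\<dots> = x \<otimes> c \<otimes> (y \<otimes> v)"
      using that assms *(1,2) by (simp add: m_ac)
    finally show "(case (u, v) of (c, d) \<Rightarrow> fraction R (x \<otimes> c) (y \<otimes> d)) =
        (case (c, d) of (c, d) \<Rightarrow> fraction R (x \<otimes> c) (y \<otimes> d))"
      using *(1,2) that assms by (simp add: frac_eq_iff integral_iff)
  qed simp
  show ?thesis
    unfolding fraction_field_def monoid.simps
  proof (subst frac_UN[OF assms(1,2)])
    fix u v assume *: "u \<in> carrier R" "v \<in> carrier R - {\<zero>}" "a \<otimes> v = u \<otimes> b"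
    have "u \<otimes> c \<otimes> (b \<otimes> d) = (u \<otimes> b) \<otimes> (c \<otimes> d)"
      using *(1,2) assms by (simp add: m_ac)
    also have "\<dots> = (a \<otimes> v) \<otimes> (c \<otimes> d)"
      by (simp only: *(3))
    also have "\<dots> = a \<otimes> c \<otimes> (v \<otimes> d)"
      using assms *(1,2) by (simp add: m_ac)
    finally show "(case (u, v) of (a, b) \<Rightarrow> \<Union>(c, d)\<in>fraction R c d. fraction R (a \<otimes> c) (b \<otimes> d)) =
        (case (a, b) of (a, b) \<Rightarrow> \<Union>(c, d)\<in>fraction R c d. fraction R (a \<otimes> c) (b \<otimes> d))"
      using * assms by (simp add: inner frac_eq_iff integral_iff)
  qed (use assms in \<open>simp add: inner\<close>)
qed

lemma frac_add:
  assumes "a \<in> carrier R" "b \<in> carrier R - {\<zero>}" "c \<in> carrier R" "d \<in> carrier R - {\<zero>}"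
  shows "fraction R a b \<oplus>\<^bsub>fraction_field R\<^esub> fraction R c d = fraction R ((a \<otimes> d) \<oplus> (c \<otimes> b)) (b \<otimes> d)"
proof -
  have key: "((x \<otimes> v) \<oplus> (u \<otimes> y)) \<otimes> (y \<otimes> d) = ((x \<otimes> d) \<oplus> (c \<otimes> y)) \<otimes> (y \<otimes> v)"
    if "x \<in> carrier R" "y \<in> carrier R" "u \<in> carrier R" "v \<in> carrier R"
      "c \<in> carrier R" "d \<in> carrier R" "c \<otimes> v = u \<otimes> d" for x y u v c d
  proof -
    have "((x \<otimes> v) \<oplus> (u \<otimes> y)) \<otimes> (y \<otimes> d) = (x \<otimes> v \<otimes> y \<otimes> d) \<oplus> (y \<otimes> y \<otimes> (u \<otimes> d))"
      using that(1-6) by (simp add: l_distr r_distr m_ac)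
    also have "\<dots> = ((x \<otimes> d) \<oplus> (c \<otimes> y)) \<otimes> (y \<otimes> v)"
      unfolding that(7)[symmetric] using that(1-6) by (simp add: l_distr r_distr m_ac)
    finally show ?thesis .
  qed
  have inner: "(\<Union>q\<in>fraction R c d. case q of (c, d) \<Rightarrow> fraction R ((x \<otimes> d) \<oplus> (c \<otimes> y)) (y \<otimes> d))
      = fraction R ((x \<otimes> d) \<oplus> (c \<otimes> y)) (y \<otimes> d)" if "x \<in> carrier R" "y \<in> carrier R - {\<zero>}" for x y
  proof (subst frac_UN[OF assms(3,4)])
    fix u v assume *: "u \<in> carrier R" "v \<in> carrier R - {\<zero>}" "c \<otimes> v = u \<otimes> d"
    show "(case (u, v) of (c, d) \<Rightarrow> fraction R ((x \<otimes> d) \<oplus> (c \<otimes> y)) (y \<otimes> d)) =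
        (case (c, d) of (c, d) \<Rightarrow> fraction R ((x \<otimes> d) \<oplus> (c \<otimes> y)) (y \<otimes> d))"
      using * that assms key[of x y u v c d] by (simp add: frac_eq_iff integral_iff)
  qed simp
  show ?thesis
    unfolding fraction_field_def ring.simps
  proof (subst frac_UN[OF assms(1,2)])
    fix u v assume *: "u \<in> carrier R" "v \<in> carrier R - {\<zero>}" "a \<otimes> v = u \<otimes> b"
    have "((u \<otimes> d) \<oplus> (c \<otimes> v)) \<otimes> (b \<otimes> d) = ((a \<otimes> d) \<oplus> (c \<otimes> b)) \<otimes> (v \<otimes> d)"
      using * assms key[of c d u v a b] by (simp add: a_comm m_comm)
    then show "(case (u, v) of (a, b) \<Rightarrow>
          \<Union>(c, d)\<in>fraction R c d. fraction R ((a \<otimes> d) \<oplus> (c \<otimes> b)) (b \<otimes> d)) =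
        (case (a, b) of (a, b) \<Rightarrow> \<Union>(c, d)\<in>fraction R c d. fraction R ((a \<otimes> d) \<oplus> (c \<otimes> b)) (b \<otimes> d))"
      using * assms by (simp add: inner frac_eq_iff integral_iff)
  qed (use assms in \<open>simp add: inner\<close>)
qed

lemma field_fraction_field: "field (fraction_field R)"
proof -
  let ?K = "fraction_field R"
  let ?P = "\<lambda>x a b. a \<in> carrier R \<and> b \<in> carrier R - {\<zero>} \<and> x = fraction R a b"
  have zK: "\<zero>\<^bsub>?K\<^esub> = fraction R \<zero> \<one>" and oK: "\<one>\<^bsub>?K\<^esub> = fraction R \<one> \<one>"
    and car: "\<And>x. x \<in> carrier ?K \<longleftrightarrow> (\<exists>a b. ?P x a b)"
    by (auto simp: fraction_field_def)
  have fracI: "fraction R a b \<in> carrier ?K" if "a \<in> carrier R" "b \<in> carrier R - {\<zero>}" for a b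
    using that car by blast
  note rules = frac_mult frac_add frac_eq_iff fracI integral_iff zK oK
  have add_assoc: "x \<oplus>\<^bsub>?K\<^esub> y \<oplus>\<^bsub>?K\<^esub> z = x \<oplus>\<^bsub>?K\<^esub> (y \<oplus>\<^bsub>?K\<^esub> z)"
    and mult_assoc: "x \<otimes>\<^bsub>?K\<^esub> y \<otimes>\<^bsub>?K\<^esub> z = x \<otimes>\<^bsub>?K\<^esub> (y \<otimes>\<^bsub>?K\<^esub> z)"
    and distr: "(x \<oplus>\<^bsub>?K\<^esub> y) \<otimes>\<^bsub>?K\<^esub> z = x \<otimes>\<^bsub>?K\<^esub> z \<oplus>\<^bsub>?K\<^esub> y \<otimes>\<^bsub>?K\<^esub> z"
    if xyz: "x \<in> carrier ?K" "y \<in> carrier ?K" "z \<in> carrier ?K" for x y z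
  proof -
    obtain a b c d e f where *: "?P x a b" "?P y c d" "?P z e f"
      using xyz unfolding car by blast
    then have C: "a \<in> carrier R" "b \<in> carrier R" "c \<in> carrier R" "d \<in> carrier R"
        "e \<in> carrier R" "f \<in> carrier R" "b \<noteq> \<zero>" "d \<noteq> \<zero>" "f \<noteq> \<zero>"
      and xyz: "x = fraction R a b" "y = fraction R c d" "z = fraction R e f"
      by blast+
    show "x \<oplus>\<^bsub>?K\<^esub> y \<oplus>\<^bsub>?K\<^esub> z = x \<oplus>\<^bsub>?K\<^esub> (y \<oplus>\<^bsub>?K\<^esub> z)"
      unfolding xyz using C by (simp add: rules) (simp add: l_distr r_distr m_ac a_ac)
    show "x \<otimes>\<^bsub>?K\<^esub> y \<otimes>\<^bsub>?K\<^esub> z = x \<otimes>\<^bsub>?K\<^esub> (y \<otimes>\<^bsub>?K\<^esub> z)"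
      unfolding xyz using C by (simp add: rules) (simp add: m_ac)
    have "((a \<otimes> d \<oplus> c \<otimes> b) \<otimes> e) \<otimes> (b \<otimes> f \<otimes> (d \<otimes> f)) =
        (a \<otimes> e \<otimes> (d \<otimes> f) \<oplus> c \<otimes> e \<otimes> (b \<otimes> f)) \<otimes> (b \<otimes> d \<otimes> f)"
      using C by (simp add: l_distr r_distr m_ac)
    then show "(x \<oplus>\<^bsub>?K\<^esub> y) \<otimes>\<^bsub>?K\<^esub> z = x \<otimes>\<^bsub>?K\<^esub> z \<oplus>\<^bsub>?K\<^esub> y \<otimes>\<^bsub>?K\<^esub> z"
      unfolding xyz using C by (simp add: rules)
  qed
  have closed: "x \<oplus>\<^bsub>?K\<^esub> y \<in> carrier ?K" "x \<otimes>\<^bsub>?K\<^esub> y \<in> carrier ?K"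
    and comm: "x \<oplus>\<^bsub>?K\<^esub> y = y \<oplus>\<^bsub>?K\<^esub> x" "x \<otimes>\<^bsub>?K\<^esub> y = y \<otimes>\<^bsub>?K\<^esub> x"
    if xy: "x \<in> carrier ?K" "y \<in> carrier ?K" for x y
  proof -
    obtain a b c d where *: "?P x a b" "?P y c d"
      using xy unfolding car by blast
    then have C: "a \<in> carrier R" "b \<in> carrier R" "c \<in> carrier R" "d \<in> carrier R"
        "b \<noteq> \<zero>" "d \<noteq> \<zero>"
      and xy: "x = fraction R a b" "y = fraction R c d"
      by blast+
    show "x \<oplus>\<^bsub>?K\<^esub> y \<in> carrier ?K" "x \<otimes>\<^bsub>?K\<^esub> y \<in> carrier ?K"
      unfolding xy using C by (simp_all add: rules)
    show "x \<oplus>\<^bsub>?K\<^esub> y = y \<oplus>\<^bsub>?K\<^esub> x" "x \<otimes>\<^bsub>?K\<^esub> y = y \<otimes>\<^bsub>?K\<^esub> x"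
      unfolding xy using C by (simp_all add: frac_mult frac_add m_comm a_comm)
  qed
  have neutral: "\<zero>\<^bsub>?K\<^esub> \<oplus>\<^bsub>?K\<^esub> x = x" "\<one>\<^bsub>?K\<^esub> \<otimes>\<^bsub>?K\<^esub> x = x"
    and neg: "\<exists>y\<in>carrier ?K. y \<oplus>\<^bsub>?K\<^esub> x = \<zero>\<^bsub>?K\<^esub>"
    and recip: "x \<noteq> \<zero>\<^bsub>?K\<^esub> \<Longrightarrow> \<exists>y\<in>carrier ?K. x \<otimes>\<^bsub>?K\<^esub> y = \<one>\<^bsub>?K\<^esub>"
    if x: "x \<in> carrier ?K" for x
  proof -
    obtain a b where *: "?P x a b"
      using x unfolding car by blast
    then have C: "a \<in> carrier R" "b \<in> carrier R" "b \<noteq> \<zero>" and x: "x = fraction R a b"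
      by blast+
    show "\<zero>\<^bsub>?K\<^esub> \<oplus>\<^bsub>?K\<^esub> x = x" "\<one>\<^bsub>?K\<^esub> \<otimes>\<^bsub>?K\<^esub> x = x"
      unfolding x using C by (simp_all add: rules)
    have "fraction R (\<ominus> a) b \<oplus>\<^bsub>?K\<^esub> x = \<zero>\<^bsub>?K\<^esub>"
      unfolding x using C by (simp add: rules l_minus l_neg)
    then show "\<exists>y\<in>carrier ?K. y \<oplus>\<^bsub>?K\<^esub> x = \<zero>\<^bsub>?K\<^esub>"
      using C by (intro bexI[of _ "fraction R (\<ominus> a) b"]) (simp_all add: fracI)
    assume "x \<noteq> \<zero>\<^bsub>?K\<^esub>"
    then have "a \<noteq> \<zero>"
      unfolding x using C by (auto simp: rules)
    then have "x \<otimes>\<^bsub>?K\<^esub> fraction R b a = \<one>\<^bsub>?K\<^esub>"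
      unfolding x using C by (simp add: rules m_comm)
    then show "\<exists>y\<in>carrier ?K. x \<otimes>\<^bsub>?K\<^esub> y = \<one>\<^bsub>?K\<^esub>"
      using C \<open>a \<noteq> \<zero>\<close> by (intro bexI[of _ "fraction R b a"]) (simp_all add: fracI)
  qed
  have zo: "\<zero>\<^bsub>?K\<^esub> \<in> carrier ?K" "\<one>\<^bsub>?K\<^esub> \<in> carrier ?K" "\<zero>\<^bsub>?K\<^esub> \<noteq> \<one>\<^bsub>?K\<^esub>"
    by (simp_all add: rules)
  have "abelian_group ?K"
    by (rule abelian_groupI) (fact closed zo add_assoc comm neutral neg)+
  moreover have "comm_monoid ?K"
    by (rule comm_monoidI) (fact closed zo mult_assoc comm neutral)+
  ultimately have "cring ?K"
    by (rule cringI) (fact distr)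
  then show ?thesis
    by (rule cring.cring_fieldI2) (fact zo recip)+
qed

end


section \<open>Dedekind domains\<close>

text \<open>Polynomials are coefficient lists with the leading coefficient at the head.\<close>

definition integral_over :: "('a, 'b) ring_scheme \<Rightarrow> 'a set \<Rightarrow> 'a \<Rightarrow> bool" where
  "integral_over K S x \<longleftrightarrow>
     (\<exists>p \<in> carrier (S[X]\<^bsub>K\<^esub>). p \<noteq> [] \<and> lead_coeff p = \<one>\<^bsub>K\<^esub> \<and> ring.eval K p x = \<zero>\<^bsub>K\<^esub>)"

definition integrally_closed :: "('a, 'b) ring_scheme \<Rightarrow> bool" where
  "integrally_closed R \<longleftrightarrow>
     (\<forall>x \<in> carrier (fraction_field R).
        integral_over (fraction_field R) ((\<lambda>a. fraction R a \<one>\<^bsub>R\<^esub>) ` carrier R) x \<longrightarrow>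
        x \<in> (\<lambda>a. fraction R a \<one>\<^bsub>R\<^esub>) ` carrier R)"

text \<open>Fields are allowed.\<close>

locale dedekind_domain = noetherian_domain +
  assumes integrally_closed: "integrally_closed R"
    and nonzero_prime_maximal: "\<lbrakk>primeideal P R; P \<noteq> {\<zero>}\<rbrakk> \<Longrightarrow> maximalideal P R"

end

theory Submission
  imports Defs
begin

text \<open>
  If the Puiseux monoid is isomorphic to the naturals, then its algebra is a polynomial ring in one
  variable over a field (\<open>UP_iso_monoid_algebra\<close>). Such a ring is Euclidean, hence a principal ideal
  domain, hence factorial, hence half-factorial. A principal ideal domain is also a Dedekind domain
  (\<open>dedekind\<close>): its integral closure is the rational root argument applied to fractions in lowest
  terms.

  What remains is to recover the monoid from the half-factorial and from the Dedekind property. Both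
  arguments look only at monomials. Because the rationals are linearly ordered, a divisor of a monomial
  is again a monomial up to a scalar (\<open>factors_of_monomial\<close>), so factorizations of \<open>X^m\<close> are
  decompositions of \<open>m\<close> in the monoid.

  If the algebra is half-factorial, the number of irreducible factors of \<open>X^m\<close> is an additive function
  on the monoid. Any two positive rationals have a common multiple, so an additive function on a
  Puiseux monoid is a multiple of the identity. The exponent of an irreducible monomial has value 1
  and therefore generates the monoid (\<open>half_factorial_imp_single_generator\<close>).

  If the algebra is noetherian and integrally closed, then integral closure shows that the monoid
  contains \<open>s - t\<close> along with any two elements \<open>t \<le> s\<close> (\<open>integrally_closed_imp_diff_mem\<close>), and the noetherian
  property provides an irreducible monomial. Its exponent is then the least positive element of the
  monoid, and division with remainder shows that it generates
  (\<open>noetherian_integrally_closed_imp_single_generator\<close>).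
\<close>

section \<open>Unique factorization fixes the number of factors\<close>

lemma essentially_equal_imp_length_eq:
  assumes "essentially_equal G fs gs"
  shows "length fs = length gs"
proof -
  obtain fs' where "fs <~~> fs'" and "fs' [\<sim>]\<^bsub>G\<^esub> gs"
    using assms unfolding essentially_equal_def by blast
  then show ?thesis
    using list_all2_lengthD mset_eq_length by metis
qed

lemma (in factorial_domain) half_factorial: "half_factorial_domain R"
proof (unfold_locales)
  fix a assume "a \<in> carrier R - {\<zero>}" "a \<notin> Units R"
  then show "\<exists>fs. set fs \<subseteq> carrier (mult_of R) \<and> factors (mult_of R) fs a"
    using factors_exist[of a] by simp
next
  fix a fs gs
  assume "a \<in> carrier R - {\<zero>}" "a \<notin> Units R" "set fs \<subseteq> carrier (mult_of R)"
    "factors (mult_of R) fs a" "set gs \<subseteq> carrier (mult_of R)" "factors (mult_of R) gs a"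
  then have "essentially_equal (mult_of R) fs gs"
    using factors_unique[of fs a gs] by simp
  then show "length fs = length gs"
    by (rule essentially_equal_imp_length_eq)
qed

section \<open>Integral closure and principal ideal domains\<close>

context domain
begin

lemma nat_pow_nonzero:
  assumes "a \<in> carrier R - {\<zero>}"
  shows "a [^] (n::nat) \<in> carrier R - {\<zero>}"
  using assms by (induction n) (auto simp: integral_iff)

lemma fraction_closed:
  assumes "a \<in> carrier R" "b \<in> carrier R - {\<zero>}"
  shows "fraction R a b \<in> carrier (fraction_field R)"
  using assms by (auto simp: fraction_field_def)

lemma embed_ring_hom: "(\<lambda>a. fraction R a \<one>) \<in> ring_hom R (fraction_field R)"
proof (rule ring_hom_memI)
  show "fraction R \<one> \<one> = \<one>\<^bsub>fraction_field R\<^esub>"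
    by (simp add: fraction_field_def)
qed (simp_all add: fraction_closed frac_mult frac_add)

lemma fraction_pow:
  assumes "a \<in> carrier R" "b \<in> carrier R - {\<zero>}"
  shows "fraction R a b [^]\<^bsub>fraction_field R\<^esub> (n::nat) = fraction R (a [^] n) (b [^] n)"
proof (induction n)
  case 0
  then show ?case by (simp add: fraction_field_def)
next
  case (Suc n)
  have "b [^] n \<in> carrier R - {\<zero>}"
    using assms by (intro nat_pow_nonzero) auto
  then show ?case
    using Suc assms by (simp add: frac_mult)
qed

text \<open>
  The fraction \<open>f/g\<close> is a zero of the monic polynomial \<open>T^n - h\<close>, so integral closure puts it into
  the ring. For monomials this turns a multiple of an exponent difference lying in the monoid into
  the difference itself lying there.
\<close>

lemma integrally_closed_root_divides:
  assumes ic: "integrally_closed R"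
    and f: "f \<in> carrier R" and g: "g \<in> carrier R - {\<zero>}" and h: "h \<in> carrier R"
    and n: "n > 0" and eq: "f [^] (n::nat) = h \<otimes> g [^] n"
  shows "g divides f"
proof -
  let ?K = "fraction_field R" and ?\<iota> = "\<lambda>a. fraction R a \<one>"
  interpret K: field ?K by (rule field_fraction_field)
  interpret \<iota>: ring_hom_ring R ?K ?\<iota>
    by (intro ring_hom_ringI2 embed_ring_hom ring_axioms K.ring_axioms)
  let ?x = "fraction R f g"
  have x: "?x \<in> carrier ?K"
    using f g by (rule fraction_closed)
  have gn: "g [^] n \<in> carrier R - {\<zero>}" for n :: nat
    using g by (rule nat_pow_nonzero)
  have xn: "?x [^]\<^bsub>?K\<^esub> n = ?\<iota> h"
    using f g h gn[of n] eq by (simp add: fraction_pow frac_eq_iff)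
  obtain m where m: "n = Suc m" using n by (cases n) auto
  \<comment> \<open>The coefficient list of \<open>T^n - h\<close>.\<close>
  let ?p = "K.monom \<one>\<^bsub>?K\<^esub> m @ [\<ominus>\<^bsub>?K\<^esub> ?\<iota> h]"
  have \<iota>c: "?\<iota> h \<in> carrier ?K" using h by simp
  have "K.eval ?p ?x = ?x [^]\<^bsub>?K\<^esub> n \<oplus>\<^bsub>?K\<^esub> \<ominus>\<^bsub>?K\<^esub> ?\<iota> h"
  proof -
    have "set (K.monom \<one>\<^bsub>?K\<^esub> m) \<subseteq> carrier ?K"
      by (auto simp: K.monom_def)
    then show ?thesis
      using x \<iota>c by (subst K.eval_append_aux) (simp_all add: K.eval_monom m)
  qed
  also have "\<dots> = \<zero>\<^bsub>?K\<^esub>"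
    using xn \<iota>c by (simp add: K.r_neg)
  finally have ev: "K.eval ?p ?x = \<zero>\<^bsub>?K\<^esub>" .
  have "\<ominus>\<^bsub>?K\<^esub> ?\<iota> h = ?\<iota> (\<ominus> h)"
    using h by simp
  moreover have "\<zero>\<^bsub>?K\<^esub> = ?\<iota> \<zero>" "\<one>\<^bsub>?K\<^esub> = ?\<iota> \<one>" by simp_all
  ultimately have "set ?p \<subseteq> ?\<iota> ` carrier R"
    using h by (auto simp: K.monom_def set_replicate_conv_if simp del: \<iota>.hom_zero \<iota>.hom_one \<iota>.hom_a_inv)
  then have "?p \<in> carrier ((?\<iota> ` carrier R)[X]\<^bsub>?K\<^esub>)"
    by (simp add: univ_poly_carrier[symmetric] polynomial_def K.monom_def)
  then have "integral_over ?K (?\<iota> ` carrier R) ?x"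
    unfolding integral_over_def using ev by (intro bexI[of _ ?p]) (simp_all add: K.monom_def)
  then obtain c where c: "c \<in> carrier R" "?x = ?\<iota> c"
    using ic x unfolding integrally_closed_def by blast
  then have "f = g \<otimes> c"
    using f g by (simp add: frac_eq_iff m_comm)
  then show ?thesis
    using c by (auto simp: factor_def)
qed

text \<open>
  The rational root argument, in a form suited to coefficient lists. If \<open>q\<close> collects the lower
  coefficients of a monic polynomial of degree \<open>n\<close>, then \<open>n\<close> is its length while its terms have
  degree at most \<open>n - 1\<close>; multiplication by \<open>b^n\<close> therefore clears all denominators of \<open>q(a/b)\<close> and
  leaves a spare factor \<open>b\<close>. If \<open>a/b\<close> is a zero of the monic polynomial, that spare factor makes \<open>b\<close>
  divide \<open>a^n\<close>.
\<close>

lemma denominator_clears_eval: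
  assumes q: "set q \<subseteq> (\<lambda>a. fraction R a \<one>) ` carrier R"
    and a: "a \<in> carrier R" and b: "b \<in> carrier R - {\<zero>}"
  shows "\<exists>e \<in> carrier R. fraction R (b [^] length q) \<one> \<otimes>\<^bsub>fraction_field R\<^esub>
           ring.eval (fraction_field R) q (fraction R a b) = fraction R (b \<otimes> e) \<one>"
proof -
  let ?K = "fraction_field R" and ?\<iota> = "\<lambda>a. fraction R a \<one>"
  interpret K: field ?K by (rule field_fraction_field)
  interpret \<iota>: ring_hom_ring R ?K ?\<iota>
    by (intro ring_hom_ringI2 embed_ring_hom ring_axioms K.ring_axioms)
  let ?x = "fraction R a b"
  have x: "?x \<in> carrier ?K"
    using a b by (rule fraction_closed)
  have bx: "?\<iota> (b [^] n) \<otimes>\<^bsub>?K\<^esub> ?x [^]\<^bsub>?K\<^esub> n = ?\<iota> (a [^] n)" for n :: nat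
  proof -
    have "b [^] n \<in> carrier R - {\<zero>}"
      using b by (rule nat_pow_nonzero)
    then show ?thesis
      using a b by (simp add: fraction_pow frac_mult frac_eq_iff m_comm)
  qed
  show ?thesis using q
  proof (induction q)
    case Nil
    have "?\<iota> (b \<otimes> \<zero>) = \<zero>\<^bsub>?K\<^esub>" using b by simp
    then show ?case using b by (intro bexI[of _ \<zero>]) simp_all
  next
    case (Cons c q)
    let ?n = "length q"
    obtain c' where c': "c' \<in> carrier R" "c = ?\<iota> c'" using Cons.prems by auto
    obtain e where e: "e \<in> carrier R" "?\<iota> (b [^] ?n) \<otimes>\<^bsub>?K\<^esub> K.eval q ?x = ?\<iota> (b \<otimes> e)"
      using Cons by auto
    have ev: "K.eval q ?x \<in> carrier ?K"
      using Cons.prems x by (intro K.eval_in_carrier) auto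
    note cl = ev x \<iota>.hom_closed a c'(1) e(1)
    have b': "b \<in> carrier R" using b by simp
    have "?\<iota> (b [^] length (c # q)) \<otimes>\<^bsub>?K\<^esub> K.eval (c # q) ?x
        = (?\<iota> b \<otimes>\<^bsub>?K\<^esub> ?\<iota> (b [^] ?n)) \<otimes>\<^bsub>?K\<^esub> (?\<iota> c' \<otimes>\<^bsub>?K\<^esub> ?x [^]\<^bsub>?K\<^esub> ?n \<oplus>\<^bsub>?K\<^esub> K.eval q ?x)"
      using b' c' by (simp add: m_comm K.m_comm)
    also have "\<dots> = ?\<iota> b \<otimes>\<^bsub>?K\<^esub> (?\<iota> c' \<otimes>\<^bsub>?K\<^esub> (?\<iota> (b [^] ?n) \<otimes>\<^bsub>?K\<^esub> ?x [^]\<^bsub>?K\<^esub> ?n)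
        \<oplus>\<^bsub>?K\<^esub> ?\<iota> (b [^] ?n) \<otimes>\<^bsub>?K\<^esub> K.eval q ?x)"
      using cl b' by (simp add: K.r_distr K.m_ac del: \<iota>.hom_nat_pow)
    also have "\<dots> = ?\<iota> (b \<otimes> (c' \<otimes> a [^] ?n \<oplus> b \<otimes> e))"
      unfolding bx e(2) using cl b' by simp
    finally show ?case using cl b' by blast
  qed
qed

text \<open>
  Multiplying the Bezout identity by \<open>a^n\<close> shows that a divisor \<open>b\<close> of \<open>a^(n+1)\<close> already divides
  \<open>a^n\<close>; the descent ends at \<open>a^0 = 1\<close>.
\<close>

lemma coprime_divides_pow_imp_unit:
  assumes "a \<in> carrier R" "b \<in> carrier R" "u \<in> carrier R" "v \<in> carrier R"
    and "u \<otimes> a \<oplus> v \<otimes> b = \<one>" and "b divides a [^] (n::nat)"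
  shows "b \<in> Units R"
  using assms(6)
proof (induction n)
  case 0
  then show ?case using assms by (simp add: divides_one)
next
  case (Suc n)
  then obtain c where c: "c \<in> carrier R" "a [^] n \<otimes> a = b \<otimes> c"
    by (auto simp: factor_def)
  have "a [^] n = a [^] n \<otimes> (u \<otimes> a \<oplus> v \<otimes> b)"
    using assms by simp
  also have "\<dots> = u \<otimes> (a [^] n \<otimes> a) \<oplus> b \<otimes> (v \<otimes> a [^] n)"
    using assms(1-4) by (simp add: r_distr m_ac)
  also have "\<dots> = b \<otimes> (u \<otimes> c \<oplus> v \<otimes> a [^] n)"
    unfolding c(2) using assms(1-4) c(1) by (simp add: r_distr m_ac)
  finally show ?case
    using assms(1-4) c(1) Suc.IH by (auto simp: factor_def)
qed

end

context principal_domain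
begin

text \<open>
  The ideal generated by numerator and denominator is principal, and dividing both by its generator
  \<open>d\<close> leaves a pair satisfying a Bezout identity.
\<close>

lemma fraction_in_lowest_terms:
  assumes "x \<in> carrier (fraction_field R)"
  obtains a b u v where "a \<in> carrier R" "b \<in> carrier R - {\<zero>}" "u \<in> carrier R" "v \<in> carrier R"
    "x = fraction R a b" "u \<otimes> a \<oplus> v \<otimes> b = \<one>"
proof -
  obtain a b where ab: "a \<in> carrier R" "b \<in> carrier R - {\<zero>}" "x = fraction R a b"
    using assms by (auto simp: fraction_field_def)
  have I: "ideal (PIdl a <+>\<^bsub>R\<^esub> PIdl b) R"
    using ab by (intro add_ideals cgenideal_ideal) auto
  then obtain d where d: "d \<in> carrier R" "PIdl a <+>\<^bsub>R\<^esub> PIdl b = PIdl d"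
    using exists_gen by blast
  have sum: "u \<otimes> a \<oplus> v \<otimes> b \<in> PIdl d" if "u \<in> carrier R" "v \<in> carrier R" for u v
  proof -
    have "u \<otimes> a \<oplus> v \<otimes> b \<in> PIdl a <+>\<^bsub>R\<^esub> PIdl b"
      using that unfolding set_add_def' cgenideal_def by auto
    then show ?thesis using d(2) by simp
  qed
  have "a \<in> PIdl d" "b \<in> PIdl d"
    using sum[of \<one> \<zero>] sum[of \<zero> \<one>] ab by simp_all
  then obtain a' b' where a': "a' \<in> carrier R" "a = a' \<otimes> d" and b': "b' \<in> carrier R" "b = b' \<otimes> d"
    unfolding cgenideal_def by blast
  have "d \<in> PIdl a <+>\<^bsub>R\<^esub> PIdl b"
    unfolding d(2) using d(1) by (rule cgenideal_self)
  then obtain u v where uv: "u \<in> carrier R" "v \<in> carrier R" "d = u \<otimes> a \<oplus> v \<otimes> b"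
    by (auto simp: set_add_def' cgenideal_def)
  have nz: "d \<noteq> \<zero>" "b' \<noteq> \<zero>" using ab b' d by auto
  have "(u \<otimes> a' \<oplus> v \<otimes> b') \<otimes> d = u \<otimes> (a' \<otimes> d) \<oplus> v \<otimes> (b' \<otimes> d)"
    using uv(1,2) a'(1) b'(1) d(1) by (simp add: l_distr m_assoc)
  also have "\<dots> = \<one> \<otimes> d"
    unfolding a'(2)[symmetric] b'(2)[symmetric] uv(3)[symmetric] using d(1) by simp
  finally have "u \<otimes> a' \<oplus> v \<otimes> b' = \<one>"
    using uv(1,2) a'(1) b'(1) d(1) nz by (subst (asm) m_rcancel) simp_all
  moreover have "x = fraction R a' b'"
    unfolding ab(3) using ab(1,2) a' b' nz d(1) by (subst frac_eq_iff) (simp_all add: m_ac)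
  ultimately show thesis
    using that a'(1) b'(1) nz(2) uv(1,2) by blast
qed

text \<open>
  If a fraction in lowest terms is integral, clearing denominators shows that its denominator divides
  a power of its numerator, hence is a unit.
\<close>

lemma integrally_closed: "integrally_closed R"
  unfolding integrally_closed_def
proof (intro ballI impI)
  let ?K = "fraction_field R" and ?\<iota> = "\<lambda>a. fraction R a \<one>"
  interpret K: field ?K by (rule field_fraction_field)
  interpret \<iota>: ring_hom_ring R ?K ?\<iota>
    by (intro ring_hom_ringI2 embed_ring_hom ring_axioms K.ring_axioms)
  fix x assume x: "x \<in> carrier ?K" and "integral_over ?K (?\<iota> ` carrier R) x"
  then obtain p where p: "p \<in> carrier ((?\<iota> ` carrier R)[X]\<^bsub>?K\<^esub>)" "p \<noteq> []"
      "lead_coeff p = \<one>\<^bsub>?K\<^esub>" "K.eval p x = \<zero>\<^bsub>?K\<^esub>"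
    unfolding integral_over_def by blast
  obtain a b u v where ab: "a \<in> carrier R" "b \<in> carrier R - {\<zero>}" "u \<in> carrier R" "v \<in> carrier R"
      "x = fraction R a b" "u \<otimes> a \<oplus> v \<otimes> b = \<one>"
    using fraction_in_lowest_terms[OF x] .
  define q where "q = tl p"
  have pq: "p = \<one>\<^bsub>?K\<^esub> # q"
    using p(2,3) unfolding q_def by (cases p) auto
  have q: "set q \<subseteq> ?\<iota> ` carrier R"
    using p(1) pq by (auto simp: univ_poly_carrier[symmetric] polynomial_def)
  let ?n = "length q"
  have evc: "K.eval q x \<in> carrier ?K"
    using q x by (intro K.eval_in_carrier) auto
  obtain e where e: "e \<in> carrier R" "?\<iota> (b [^] ?n) \<otimes>\<^bsub>?K\<^esub> K.eval q x = ?\<iota> (b \<otimes> e)"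
    using denominator_clears_eval[OF q ab(1,2)] ab(5) by auto
  have bn: "b [^] ?n \<in> carrier R - {\<zero>}"
    using ab(2) by (rule nat_pow_nonzero)
  have bx: "?\<iota> (b [^] ?n) \<otimes>\<^bsub>?K\<^esub> x [^]\<^bsub>?K\<^esub> ?n = ?\<iota> (a [^] ?n)"
    using ab(1,2) bn by (simp add: ab(5) fraction_pow frac_mult frac_eq_iff m_comm)
  have "\<zero>\<^bsub>?K\<^esub> = ?\<iota> (b [^] ?n) \<otimes>\<^bsub>?K\<^esub> (x [^]\<^bsub>?K\<^esub> ?n \<oplus>\<^bsub>?K\<^esub> K.eval q x)"
    using p(4) ab(2) x bn by (simp add: pq)
  also have "\<dots> = ?\<iota> (a [^] ?n) \<oplus>\<^bsub>?K\<^esub> ?\<iota> (b \<otimes> e)"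
    using K.r_distr[of "x [^]\<^bsub>?K\<^esub> ?n" "K.eval q x" "?\<iota> (b [^] ?n)"] x bn evc e bx
    by (simp del: \<iota>.hom_nat_pow \<iota>.hom_mult)
  also have "\<dots> = ?\<iota> (a [^] ?n \<oplus> b \<otimes> e)"
    using ab(1,2) e(1) by simp
  finally have "?\<iota> (a [^] ?n \<oplus> b \<otimes> e) = ?\<iota> \<zero>"
    by simp
  then have "a [^] ?n \<oplus> b \<otimes> e = \<zero>"
    using ab(1,2) e(1) by (subst (asm) frac_eq_iff) simp_all
  then have "a [^] ?n = b \<otimes> (\<ominus> e)"
    using ab(1,2) e(1) by (simp add: r_minus sum_zero_eq_neg)
  then have "b divides a [^] ?n"
    using e(1) by (auto simp: factor_def)
  then have "b \<in> Units R"
    using coprime_divides_pow_imp_unit ab by blast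
  then have "x = ?\<iota> (a \<otimes> inv b)"
    unfolding ab(5) using ab(1,2) by (subst frac_eq_iff) (simp_all add: m_assoc)
  then show "x \<in> ?\<iota> ` carrier R"
    using ab(1) \<open>b \<in> Units R\<close> by blast
qed

text \<open>
  A nonzero prime ideal has a prime generator, which is irreducible, and an irreducible element of a
  principal ideal domain generates a maximal ideal.
\<close>

lemma dedekind: "dedekind_domain R"
proof (intro dedekind_domain.intro dedekind_domain_axioms.intro noetherian_domain_axioms)
  show "integrally_closed R" by (rule integrally_closed)
  fix P assume P: "primeideal P R" "P \<noteq> {\<zero>}"
  then obtain p where p: "p \<in> carrier R" "P = PIdl p"
    using exists_gen primeideal.axioms(1) by blast
  then have "p \<noteq> \<zero>"
    using P(2) genideal_zero cgenideal_eq_genideal by auto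
  then have "ring_prime p"
    using P(1) p primeideal_iff_prime by simp
  then have "ring_irreducible p"
    using p(1) \<open>p \<noteq> \<zero>\<close> mult_of.prime_irreducible ring_irreducibleI' ring_primeE(2) by simp
  then show "maximalideal P R"
    using irreducible_imp_maximalideal p by simp
qed

end

section \<open>Polynomials and the monoid algebra of the naturals\<close>

lemma (in domain) euclidean_domain_ring_iso:
  assumes euc: "euclidean_domain R \<phi>" and h: "h \<in> ring_iso R S" and z: "h \<zero> = \<zero>\<^bsub>S\<^esub>"
  shows "euclidean_domain S (\<phi> \<circ> inv_into (carrier R) h)"
proof -
  have bij: "bij_betw h (carrier R) (carrier S)"
    using h by (simp add: ring_iso_def)
  have "S\<lparr>zero := h \<zero>\<rparr> = S" using z by simp
  then interpret S: "domain" S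
    using ring_iso_imp_img_domain[OF h] by simp
  let ?g = "inv_into (carrier R) h"
  have gh: "?g (h a) = a" if "a \<in> carrier R" for a
    using that bij by (simp add: bij_betw_def)
  have surj: "\<exists>a' \<in> carrier R. a = h a'" if "a \<in> carrier S" for a
    using that bij by (auto simp: bij_betw_def)
  show ?thesis
  proof (rule S.euclidean_domainI)
    fix a b assume "a \<in> carrier S - {\<zero>\<^bsub>S\<^esub>}" "b \<in> carrier S - {\<zero>\<^bsub>S\<^esub>}"
    then obtain a' b' where a': "a' \<in> carrier R - {\<zero>}" "a = h a'"
        and b': "b' \<in> carrier R - {\<zero>}" "b = h b'"
      using surj z by (metis DiffD1 DiffD2 DiffI singleton_iff)
    obtain q r where qr: "q \<in> carrier R" "r \<in> carrier R" "a' = b' \<otimes> q \<oplus> r" "r = \<zero> \<or> \<phi> r < \<phi> b'"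
      using euclidean_domain.euclidean_function[OF euc a'(1) b'(1)] by blast
    have "h q \<in> carrier S \<and> h r \<in> carrier S \<and> a = b \<otimes>\<^bsub>S\<^esub> h q \<oplus>\<^bsub>S\<^esub> h r \<and>
        (h r = \<zero>\<^bsub>S\<^esub> \<or> (\<phi> \<circ> ?g) (h r) < (\<phi> \<circ> ?g) b)"
      using qr a' b' h z by (auto simp: gh ring_iso_memE)
    then show "\<exists>q r. q \<in> carrier S \<and> r \<in> carrier S \<and> a = b \<otimes>\<^bsub>S\<^esub> q \<oplus>\<^bsub>S\<^esub> r \<and>
        (r = \<zero>\<^bsub>S\<^esub> \<or> (\<phi> \<circ> ?g) r < (\<phi> \<circ> ?g) b)"
      by blast
  qed
qed

text \<open>
  Over a commutative ring, division with remainder by \<open>g\<close> needs \<open>f\<close> to be multiplied by a power of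
  the leading coefficient of \<open>g\<close>; over a field that power can be divided out again.
\<close>

lemma (in field) UP_euclidean: "euclidean_domain (UP R) (deg R)"
proof -
  let ?P = "UP R"
  interpret U: UP_domain R ?P
    by unfold_locales simp_all
  show ?thesis
  proof (rule domain.euclidean_domainI[OF U.UP_domain])
    fix f g assume f: "f \<in> carrier ?P - {\<zero>\<^bsub>?P\<^esub>}" and g: "g \<in> carrier ?P - {\<zero>\<^bsub>?P\<^esub>}"
    let ?l = "up_ring.coeff ?P g (deg R g)"
    obtain q r k where qr: "q \<in> carrier ?P" "r \<in> carrier ?P"
        "?l [^] (k::nat) \<odot>\<^bsub>?P\<^esub> f = g \<otimes>\<^bsub>?P\<^esub> q \<oplus>\<^bsub>?P\<^esub> r" "r = \<zero>\<^bsub>?P\<^esub> \<or> deg R r < deg R g"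
      using U.long_div_theorem[of g f] f g by auto
    have "?l \<in> carrier R" "?l \<noteq> \<zero>"
      using g U.lcoeff_nonzero by auto
    then have "?l [^] k \<in> Units R"
      using field_Units Units_pow_closed[of ?l k] by simp
    then obtain c where c: "c \<in> carrier R" "c \<otimes> ?l [^] k = \<one>" "?l [^] k \<in> carrier R"
      by (meson Units_closed Units_l_inv_ex)
    have cn: "c \<noteq> \<zero>" using c by auto
    have "f = c \<odot>\<^bsub>?P\<^esub> (?l [^] k \<odot>\<^bsub>?P\<^esub> f)"
      using c f by (simp add: U.smult_assoc1[symmetric])
    also have "\<dots> = g \<otimes>\<^bsub>?P\<^esub> (c \<odot>\<^bsub>?P\<^esub> q) \<oplus>\<^bsub>?P\<^esub> c \<odot>\<^bsub>?P\<^esub> r"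
      unfolding qr(3) using c(1) qr(1,2) g by (simp add: U.smult_r_distr U.P.m_comm[of g] U.smult_assoc2)
    finally have "f = g \<otimes>\<^bsub>?P\<^esub> (c \<odot>\<^bsub>?P\<^esub> q) \<oplus>\<^bsub>?P\<^esub> c \<odot>\<^bsub>?P\<^esub> r" .
    moreover have "c \<odot>\<^bsub>?P\<^esub> r = \<zero>\<^bsub>?P\<^esub> \<or> deg R (c \<odot>\<^bsub>?P\<^esub> r) < deg R g"
      using qr(2,4) c(1) cn by auto
    ultimately show "\<exists>q r. q \<in> carrier ?P \<and> r \<in> carrier ?P \<and> f = g \<otimes>\<^bsub>?P\<^esub> q \<oplus>\<^bsub>?P\<^esub> r \<and>
        (r = \<zero>\<^bsub>?P\<^esub> \<or> deg R r < deg R g)"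
      using U.smult_closed[OF c(1) qr(1)] U.smult_closed[OF c(1) qr(2)] by blast
  qed
qed

lemma carrier_UP: "carrier (UP R) = up R"
  by (simp add: UP_def)

lemma coeff_UP: "p \<in> up R \<Longrightarrow> up_ring.coeff (UP R) p = p"
  by (auto simp: UP_def)

text \<open>
  Relabelling exponents along \<open>h\<close> turns convolution over the monoid into convolution over the
  naturals. The two product formulas are summed over different sets: polynomial multiplication runs
  over all splittings \<open>i + (n - i)\<close> of the degree, the monoid algebra only over pairs of exponents
  from the supports. The additional terms on the polynomial side vanish.
\<close>

lemma (in cring) UP_iso_monoid_algebra:
  assumes G: "monoid G" and h: "h \<in> iso G nat_add_monoid"
  shows "(\<lambda>p s. if s \<in> carrier G then up_ring.coeff (UP R) p (h s) else \<zero>)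
           \<in> ring_iso (UP R) (monoid_algebra R G)" (is "?T \<in> _")
proof -
  let ?P = "UP R" and ?A = "monoid_algebra R G"
  interpret G: monoid G by (rule G)
  interpret U: UP_cring R ?P
    by unfold_locales simp_all
  have bij: "bij_betw h (carrier G) UNIV"
    and hm: "\<And>x y. x \<in> carrier G \<Longrightarrow> y \<in> carrier G \<Longrightarrow> h (x \<otimes>\<^bsub>G\<^esub> y) = h x + h y"
    using h by (auto simp: iso_def hom_def nat_add_monoid_def)
  have h1: "h \<one>\<^bsub>G\<^esub> = 0"
    using hm[of "\<one>\<^bsub>G\<^esub>" "\<one>\<^bsub>G\<^esub>"] by simp
  have hinj: "h x = h y \<longleftrightarrow> x = y" if "x \<in> carrier G" "y \<in> carrier G" for x y
    using that bij by (auto simp: bij_betw_def inj_on_def)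
  have hsurj: "\<exists>x \<in> carrier G. h x = n" for n
    using bij by (metis UNIV_I bij_betw_iff_bijections)
  have Tc: "?T p \<in> carrier ?A" if p: "p \<in> carrier ?P" for p
  proof -
    have "supp R (?T p) \<subseteq> h -` {..deg R p} \<inter> carrier G"
      using p U.deg_aboveD[OF _ p] by (auto simp: supp_def not_less[symmetric] split: if_splits)
    moreover have "finite (h -` {..deg R p} \<inter> carrier G)"
      using bij by (intro finite_vimage_IntI) (auto simp: bij_betw_def)
    ultimately have "supp R (?T p) \<subseteq> carrier G" "finite (supp R (?T p))"
      by (simp, rule finite_subset)
    then show ?thesis
      using p by (auto simp: monoid_algebra_def)
  qed
  show ?thesis
  proof (rule ring_iso_memI)
    fix p assume "p \<in> carrier ?P"
    then show "?T p \<in> carrier ?A" by (rule Tc)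
  next
    fix p q assume p: "p \<in> carrier ?P" and q: "q \<in> carrier ?P"
    then show "?T (p \<oplus>\<^bsub>?P\<^esub> q) = ?T p \<oplus>\<^bsub>?A\<^esub> ?T q"
      by (auto simp: monoid_algebra_def fun_eq_iff)
    define f where "f = ?T p"
    define g where "g = ?T q"
    have f: "f u = (if u \<in> carrier G then up_ring.coeff ?P p (h u) else \<zero>)"
      and g: "g u = (if u \<in> carrier G then up_ring.coeff ?P q (h u) else \<zero>)" for u
      by (simp_all add: f_def g_def)
    have sc: "supp R f \<subseteq> carrier G" "supp R g \<subseteq> carrier G"
      by (auto simp: supp_def f g split: if_splits)
    have "?T (p \<otimes>\<^bsub>?P\<^esub> q) s = (f \<otimes>\<^bsub>?A\<^esub> g) s" for s
    proof -
      define I where "I = {u \<in> supp R f \<times> supp R g. fst u \<otimes>\<^bsub>G\<^esub> snd u = s}"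
      have I: "fst u \<in> carrier G" "snd u \<in> carrier G" "fst u \<otimes>\<^bsub>G\<^esub> snd u = s" if "u \<in> I" for u
        using that sc by (auto simp: I_def)
      have fg: "(f \<otimes>\<^bsub>?A\<^esub> g) s = (\<Oplus>u\<in>I. f (fst u) \<otimes> g (snd u))"
        by (simp add: monoid_algebra_def I_def)
      show ?thesis
      proof (cases "s \<in> carrier G")
        case False
        then have "I = {}" using I by (metis G.m_closed equals0I)
        then show ?thesis unfolding fg using False by simp
      next
        case True
        have hI: "h s = h (fst u) + h (snd u)" if "u \<in> I" for u
          using I[OF that] hm by metis
        have inj: "inj_on (\<lambda>u. h (fst u)) I"
        proof (rule inj_onI)
          fix u v assume uv: "u \<in> I" "v \<in> I" "h (fst u) = h (fst v)"
          then have "h (snd u) = h (snd v)" using hI[of u] hI[of v] by simp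
          then show "u = v"
            using uv(3) I[OF uv(1)] I[OF uv(2)] hinj by (simp add: prod_eq_iff)
        qed
        have "?T (p \<otimes>\<^bsub>?P\<^esub> q) s
            = (\<Oplus>i\<in>{..h s}. up_ring.coeff ?P p i \<otimes> up_ring.coeff ?P q (h s - i))"
          using True p q by simp
        also have "\<dots> = (\<Oplus>i\<in>(\<lambda>u. h (fst u)) ` I. up_ring.coeff ?P p i \<otimes> up_ring.coeff ?P q (h s - i))"
        proof (rule add.finprod_mono_neutral_cong_right)
          show "(\<lambda>u. h (fst u)) ` I \<subseteq> {..h s}"
            using hI by auto
          show "up_ring.coeff ?P p i \<otimes> up_ring.coeff ?P q (h s - i) = \<zero>"
            if i: "i \<in> {..h s} - (\<lambda>u. h (fst u)) ` I" for i
          proof (rule ccontr)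
            assume nz: "up_ring.coeff ?P p i \<otimes> up_ring.coeff ?P q (h s - i) \<noteq> \<zero>"
            obtain x y where xy: "x \<in> carrier G" "h x = i" "y \<in> carrier G" "h y = h s - i"
              using hsurj by metis
            have "h (x \<otimes>\<^bsub>G\<^esub> y) = h s" using xy i hm by simp
            then have "x \<otimes>\<^bsub>G\<^esub> y = s" using xy True hinj by simp
            moreover have "up_ring.coeff ?P p i \<noteq> \<zero>" "up_ring.coeff ?P q (h s - i) \<noteq> \<zero>"
              using nz p q by auto
            ultimately have "(x, y) \<in> I"
              using xy by (simp add: supp_def I_def f g)
            then have "h (fst (x, y)) \<in> (\<lambda>u. h (fst u)) ` I" by (rule imageI)
            then show False using i xy(2) by simp
          qed
        qed (use p q in auto)
        also have "\<dots> = (\<Oplus>u\<in>I. up_ring.coeff ?P p (h (fst u)) \<otimes> up_ring.coeff ?P q (h s - h (fst u)))"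
          using p q by (intro add.finprod_reindex inj) auto
        also have "\<dots> = (\<Oplus>u\<in>I. f (fst u) \<otimes> g (snd u))"
          using p q I hI by (intro add.finprod_cong') (auto simp: f g)
        finally show ?thesis unfolding fg .
      qed
    qed
    then show "?T (p \<otimes>\<^bsub>?P\<^esub> q) = ?T p \<otimes>\<^bsub>?A\<^esub> ?T q"
      unfolding f_def g_def by (rule ext)
  next
    show "?T \<one>\<^bsub>?P\<^esub> = \<one>\<^bsub>?A\<^esub>"
      using h1 hinj[of _ "\<one>\<^bsub>G\<^esub>"] by (auto simp: monoid_algebra_def fun_eq_iff)
    show "bij_betw ?T (carrier ?P) (carrier ?A)"
    proof (rule bij_betw_imageI)
      show "inj_on ?T (carrier ?P)"
      proof (rule inj_onI)
        fix p q assume pq: "p \<in> carrier ?P" "q \<in> carrier ?P" "?T p = ?T q"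
        show "p = q"
        proof (rule U.up_eqI)
          fix n
          obtain x where "x \<in> carrier G" "h x = n" using hsurj by blast
          then show "up_ring.coeff ?P p n = up_ring.coeff ?P q n"
            using fun_cong[OF pq(3), of x] by simp
        qed (use pq in auto)
      qed
      show "?T ` carrier ?P = carrier ?A"
      proof (intro equalityI subsetI)
        fix f assume f: "f \<in> carrier ?A"
        then have f': "\<And>s. f s \<in> carrier R" "supp R f \<subseteq> carrier G" "finite (supp R f)"
          by (auto simp: monoid_algebra_def)
        let ?g = "inv_into (carrier G) h"
        have hg: "?g n \<in> carrier G" "h (?g n) = n" for n
          using bij by (metis UNIV_I bij_betw_def inv_into_into f_inv_into_f)+
        have gh: "?g (h s) = s" if "s \<in> carrier G" for s
          using that bij by (simp add: bij_betw_def)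
        define p where "p = (\<lambda>n. f (?g n))"
        have "bound \<zero> (Max (h ` supp R f)) p"
        proof
          fix m assume m: "Max (h ` supp R f) < m"
          show "p m = \<zero>"
          proof (rule ccontr)
            assume "p m \<noteq> \<zero>"
            then have "m \<in> h ` supp R f" using hg(2)[of m] by (force simp: p_def supp_def)
            then show False using m f'(3) by (meson Max_ge finite_imageI not_le)
          qed
        qed
        then have "\<exists>n. bound \<zero> n p" ..
        moreover have "p n \<in> carrier R" for n
          using f'(1) by (simp add: p_def)
        ultimately have "p \<in> up R" by (rule mem_upI[rotated])
        then have p: "p \<in> carrier ?P" "up_ring.coeff ?P p = p"
          by (simp_all only: carrier_UP coeff_UP)
        have "?T p s = f s" for s
        proof (cases "s \<in> carrier G")
          case True
          then show ?thesis by (simp add: p(2)) (simp add: p_def gh)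
        next
          case False
          then have "f s = \<zero>" using f'(2) by (auto simp: supp_def)
          then show ?thesis using False by simp
        qed
        then have "?T p = f" by (rule ext)
        then show "f \<in> ?T ` carrier ?P" using p(1) by blast
      qed (use Tc in auto)
    qed
  qed
qed

lemma (in field) monoid_algebra_euclidean:
  assumes G: "monoid G" and iso: "G \<cong> nat_add_monoid"
  shows "\<exists>\<phi>. euclidean_domain (monoid_algebra R G) \<phi>"
proof -
  obtain h where h: "h \<in> iso G nat_add_monoid"
    using iso by (auto simp: is_iso_def)
  let ?T = "\<lambda>p s. if s \<in> carrier G then up_ring.coeff (UP R) p (h s) else \<zero>"
  interpret U: UP_domain R "UP R"
    by unfold_locales simp_all
  have "?T \<zero>\<^bsub>UP R\<^esub> = \<zero>\<^bsub>monoid_algebra R G\<^esub>"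
    by (auto simp: monoid_algebra_def)
  from domain.euclidean_domain_ring_iso[of "UP R" _ ?T, OF U.UP_domain UP_euclidean
      UP_iso_monoid_algebra[OF G h] this]
  show ?thesis by blast
qed

section \<open>Cyclic Puiseux monoids\<close>

text \<open>
  Any two nonzero elements of a Puiseux monoid have a common multiple; this is what distinguishes
  these monoids from torsion-free monoids of higher rank.
\<close>

lemma positive_rats_commensurable:
  fixes a b :: rat
  assumes "a > 0" "b > 0"
  obtains m n :: nat where "m > 0" "n > 0" "of_nat m * a = of_nat n * b"
proof -
  obtain p q where pq: "a / b = Fract p q" "q > 0"
    by (cases "a / b") auto
  then have "p > 0"
    using assms zero_less_Fract_iff by (metis zero_less_divide_iff)
  have "a / b = of_int p / of_int q"
    using pq by (simp add: Fract_of_int_quotient)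
  then have "of_nat (nat q) * a = of_nat (nat p) * b"
    using assms pq(2) \<open>p > 0\<close> by (simp add: field_simps)
  then show thesis
    using that[of "nat q" "nat p"] pq(2) \<open>p > 0\<close> by simp
qed

lemma submultiples_iso_nat:
  assumes "puiseux_monoid M" and "s \<in> M" and "s > 0"
    and gen: "\<And>m. m \<in> M \<Longrightarrow> \<exists>n. m = of_nat n * s"
  shows "monoid_of M \<cong> nat_add_monoid"
proof -
  interpret M: submonoid M nonneg_rat_monoid
    using assms(1) by (simp add: puiseux_monoid_def)
  have mem: "of_nat n * s \<in> M" for n
  proof (induction n)
    case 0
    then show ?case using M.one_closed by (simp add: nonneg_rat_monoid_def)
  next
    case (Suc n)
    then show ?case using M.m_closed[OF \<open>s \<in> M\<close>, of "of_nat n * s"]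
      by (simp add: nonneg_rat_monoid_def algebra_simps)
  qed
  \<comment> \<open>The quotient is a natural number on \<open>M\<close>; rounding only serves to change its type.\<close>
  let ?h = "\<lambda>m. nat \<lfloor>m / s\<rfloor>"
  have h: "?h (of_nat n * s) = n" for n
    using \<open>s > 0\<close> by simp
  have "?h (m + m') = ?h m + ?h m'" if mm': "m \<in> M" "m' \<in> M" for m m'
  proof -
    obtain n n' where "m = of_nat n * s" "m' = of_nat n' * s"
      using gen[OF mm'(1)] gen[OF mm'(2)] by blast
    then show ?thesis
      using h[of n] h[of n'] h[of "n + n'"] by (simp add: distrib_right)
  qed
  moreover have "bij_betw ?h M UNIV"
  proof (rule bij_betw_byWitness[where f' = "\<lambda>n. of_nat n * s"])
    show "\<forall>m\<in>M. of_nat (?h m) * s = m"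
      using gen h by fastforce
  qed (use mem h in auto)
  ultimately have "?h \<in> iso (monoid_of M) nat_add_monoid"
    by (simp add: iso_def hom_def nat_add_monoid_def nonneg_rat_monoid_def)
  then show ?thesis by (rule is_isoI)
qed

section \<open>Monomials in the algebra of a Puiseux monoid\<close>

text \<open>
  The coefficient is kept because divisors of \<open>X^s\<close> are powers of \<open>X\<close> only up to a scalar.
\<close>

definition monomial :: "('f, 'b) ring_scheme \<Rightarrow> 'f \<Rightarrow> 'm \<Rightarrow> 'm \<Rightarrow> 'f" where
  "monomial F c s = (\<lambda>t. if t = s then c else \<zero>\<^bsub>F\<^esub>)"

locale puiseux_algebra = field F for F :: "('f, 'b) ring_scheme" (structure) +
  fixes M :: "rat set"
  assumes puiseux: "puiseux_monoid M"
begin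

abbreviation A :: "(rat \<Rightarrow> 'f) ring" where
  "A \<equiv> monoid_algebra F (monoid_of M)"

abbreviation Xpow :: "rat \<Rightarrow> rat \<Rightarrow> 'f" where
  "Xpow \<equiv> monomial F \<one>"

lemma zero_mem: "0 \<in> M" and add_mem: "s \<in> M \<Longrightarrow> t \<in> M \<Longrightarrow> s + t \<in> M"
  and nonneg: "s \<in> M \<Longrightarrow> 0 \<le> s"
proof -
  interpret M: submonoid M nonneg_rat_monoid
    using puiseux by (simp add: puiseux_monoid_def)
  show "0 \<in> M" "s \<in> M \<Longrightarrow> t \<in> M \<Longrightarrow> s + t \<in> M" "s \<in> M \<Longrightarrow> 0 \<le> s"
    using M.one_closed M.m_closed M.subset by (auto simp: nonneg_rat_monoid_def)
qed

lemma of_nat_mult_mem: "s \<in> M \<Longrightarrow> of_nat n * s \<in> M"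
  by (induction n) (auto simp: zero_mem add_mem algebra_simps)

lemma monoid_monoid_of: "monoid (monoid_of M)"
  by (rule monoidI) (simp_all add: nonneg_rat_monoid_def zero_mem add_mem)

lemma carrierD:
  assumes "f \<in> carrier A"
  shows "f s \<in> carrier F" "supp F f \<subseteq> M" "finite (supp F f)"
  using assms by (auto simp: monoid_algebra_def)

lemma zero_A: "\<zero>\<^bsub>A\<^esub> = (\<lambda>_. \<zero>)"
  by (simp add: monoid_algebra_def)

lemma one_A: "\<one>\<^bsub>A\<^esub> = Xpow 0"
  by (auto simp: monoid_algebra_def nonneg_rat_monoid_def monomial_def)

lemma supp_monomial: "c \<noteq> \<zero> \<Longrightarrow> supp F (monomial F c s) = {s}"
  by (auto simp: supp_def monomial_def)

lemma monomial_closed: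
  assumes "c \<in> carrier F" "s \<in> M"
  shows "monomial F c s \<in> carrier A"
proof -
  have "supp F (monomial F c s) \<subseteq> {s}"
    by (auto simp: supp_def monomial_def)
  then show ?thesis
    using assms finite_subset[of "supp F (monomial F c s)" "{s}"]
    by (auto simp: monoid_algebra_def monomial_def)
qed

lemma monomial_nonzero: "c \<noteq> \<zero> \<Longrightarrow> monomial F c s \<noteq> \<zero>\<^bsub>A\<^esub>"
  by (auto simp: zero_A monomial_def fun_eq_iff)

lemma monomial_eq_iff:
  assumes "c \<noteq> \<zero>"
  shows "monomial F c s = monomial F d t \<longleftrightarrow> c = d \<and> s = t"
  using assms by (auto simp: monomial_def fun_eq_iff split: if_splits)

lemma mult_A:
  "(f \<otimes>\<^bsub>A\<^esub> g) s = (\<Oplus>p\<in>{p \<in> supp F f \<times> supp F g. fst p + snd p = s}. f (fst p) \<otimes> g (snd p))"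
  by (simp add: monoid_algebra_def nonneg_rat_monoid_def)

text \<open>
  When an exponent arises in only one way as a sum of exponents of the factors, nothing can cancel
  its coefficient. Both the sum of the largest and the sum of the smallest exponents are of this kind.
\<close>

lemma mult_coeff_unique_sum:
  assumes f: "f \<in> carrier A" and g: "g \<in> carrier A" and u: "u \<in> supp F f" and v: "v \<in> supp F g"
    and unique: "\<And>u' v'. u' \<in> supp F f \<Longrightarrow> v' \<in> supp F g \<Longrightarrow> u' + v' = u + v \<Longrightarrow> u' = u \<and> v' = v"
  shows "(f \<otimes>\<^bsub>A\<^esub> g) (u + v) = f u \<otimes> g v"
proof -
  have "{p \<in> supp F f \<times> supp F g. fst p + snd p = u + v} = {(u, v)}"
    using u v unique by auto
  then show ?thesis
    using f g by (simp add: mult_A carrierD)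
qed

lemma monomial_mult:
  assumes c: "c \<in> carrier F - {\<zero>}" and d: "d \<in> carrier F - {\<zero>}" and s: "s \<in> M" and t: "t \<in> M"
  shows "monomial F c s \<otimes>\<^bsub>A\<^esub> monomial F d t = monomial F (c \<otimes> d) (s + t)"
proof
  fix r
  show "(monomial F c s \<otimes>\<^bsub>A\<^esub> monomial F d t) r = monomial F (c \<otimes> d) (s + t) r"
  proof (cases "r = s + t")
    case True
    show ?thesis
      unfolding True using c d s t
      by (subst mult_coeff_unique_sum) (auto simp: monomial_closed supp_monomial, simp add: monomial_def)
  next
    case False
    then have "{p \<in> supp F (monomial F c s) \<times> supp F (monomial F d t). fst p + snd p = r} = {}"
      using c d by (auto simp: supp_monomial)
    then show ?thesis
      using False by (simp only: mult_A) (simp add: monomial_def)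
  qed
qed

lemma Xpow_add: "s \<in> M \<Longrightarrow> t \<in> M \<Longrightarrow> Xpow (s + t) = Xpow s \<otimes>\<^bsub>A\<^esub> Xpow t"
  by (subst monomial_mult) auto

lemma Xpow_of_nat_mult: "s \<in> M \<Longrightarrow> Xpow (of_nat n * s) = Xpow s [^]\<^bsub>A\<^esub> n"
proof (induction n)
  case (Suc n)
  then show ?case
    using Xpow_add[of "of_nat n * s" s] of_nat_mult_mem[of s n] by (simp add: algebra_simps)
qed (simp add: one_A)

text \<open>
  The largest exponents of \<open>f\<close> and \<open>g\<close> add up to an exponent of \<open>f g\<close>, and so do the smallest ones.
  As \<open>f g\<close> has the single exponent \<open>m\<close>, the largest and the smallest exponent agree in each factor.
\<close>

lemma factors_of_monomial:
  assumes f: "f \<in> carrier A" and g: "g \<in> carrier A" and fg: "f \<otimes>\<^bsub>A\<^esub> g = monomial F c m"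
    and c: "c \<noteq> \<zero>"
  obtains a s b t where "a \<in> carrier F - {\<zero>}" "s \<in> M" "f = monomial F a s"
    "b \<in> carrier F - {\<zero>}" "t \<in> M" "g = monomial F b t" "s + t = m"
proof -
  let ?S = "supp F f" and ?T = "supp F g"
  note fin = carrierD(3)[OF f] carrierD(3)[OF g]
  have ne: "?S \<noteq> {}" "?T \<noteq> {}"
  proof -
    have "(f \<otimes>\<^bsub>A\<^esub> g) m \<noteq> \<zero>"
      using c by (simp add: fg monomial_def)
    then have "{p \<in> ?S \<times> ?T. fst p + snd p = m} \<noteq> {}"
      unfolding mult_A using finsum_empty by metis
    then show "?S \<noteq> {}" "?T \<noteq> {}" by auto
  qed
  have extreme: "u + v = m" if u: "u \<in> ?S" and v: "v \<in> ?T"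
    and unique: "\<And>u' v'. u' \<in> ?S \<Longrightarrow> v' \<in> ?T \<Longrightarrow> u' + v' = u + v \<Longrightarrow> u' = u \<and> v' = v" for u v
  proof -
    have "(f \<otimes>\<^bsub>A\<^esub> g) (u + v) = f u \<otimes> g v"
      using mult_coeff_unique_sum[OF f g u v unique] .
    also have "\<dots> \<noteq> \<zero>"
      using u v f g carrierD(1) by (auto simp: supp_def integral_iff)
    finally show ?thesis
      by (auto simp: fg monomial_def split: if_splits)
  qed
  have "Max ?S + Max ?T = m"
  proof (rule extreme)
    fix u v assume "u \<in> ?S" "v \<in> ?T" "u + v = Max ?S + Max ?T"
    moreover from this have "u \<le> Max ?S" "v \<le> Max ?T" using fin by auto
    ultimately show "u = Max ?S \<and> v = Max ?T" by linarith
  qed (use fin ne in auto)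
  moreover have "Min ?S + Min ?T = m"
  proof (rule extreme)
    fix u v assume "u \<in> ?S" "v \<in> ?T" "u + v = Min ?S + Min ?T"
    moreover from this have "u \<ge> Min ?S" "v \<ge> Min ?T" using fin by auto
    ultimately show "u = Min ?S \<and> v = Min ?T" by linarith
  qed (use fin ne in auto)
  moreover have le: "Min ?S \<le> Max ?S" "Min ?T \<le> Max ?T" using fin ne by simp_all
  ultimately have eq: "Min ?S = Max ?S" "Min ?T = Max ?T" by linarith+
  have singleton: "U = {Max U}" if "finite U" "U \<noteq> {}" "Min U = Max U" for U :: "rat set"
  proof -
    have "u = Max U" if "u \<in> U" for u
      using \<open>finite U\<close> \<open>Min U = Max U\<close> that by (metis Max_ge Min_le order_antisym)
    then show ?thesis using Max_in[OF \<open>finite U\<close> \<open>U \<noteq> {}\<close>] by blast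
  qed
  have S: "?S = {Max ?S}" and T: "?T = {Max ?T}"
    by (rule singleton; fact fin ne eq)+
  have "f = monomial F (f (Max ?S)) (Max ?S)"
    using S by (auto simp: monomial_def supp_def fun_eq_iff)
  moreover have "g = monomial F (g (Max ?T)) (Max ?T)"
    using T by (auto simp: monomial_def supp_def fun_eq_iff)
  moreover have "Max ?S \<in> ?S" "Max ?T \<in> ?T" using fin ne by simp_all
  ultimately show thesis
    using that[of "f (Max ?S)" "Max ?S" "g (Max ?T)" "Max ?T"] \<open>Max ?S + Max ?T = m\<close>
      carrierD[OF f] carrierD[OF g] by (auto simp: supp_def)
qed

text \<open>
  Exponents are nonnegative, so \<open>s + t = 0\<close> forces both to vanish. Commutative multiplication is a
  hypothesis here because in each application it comes from the ring condition under study.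
\<close>

lemma monomial_Units_iff:
  assumes c: "c \<in> carrier F - {\<zero>}" and s: "s \<in> M" and comm: "comm_monoid A"
  shows "monomial F c s \<in> Units A \<longleftrightarrow> s = 0"
proof
  interpret A: comm_monoid A by (rule comm)
  assume "monomial F c s \<in> Units A"
  then obtain g where g: "g \<in> carrier A" "monomial F c s \<otimes>\<^bsub>A\<^esub> g = Xpow 0"
    using A.Units_r_inv_ex unfolding one_A[symmetric] by blast
  have "monomial F c s \<in> carrier A"
    using c s by (simp add: monomial_closed)
  from this g obtain a s' t where "s' \<in> M" "t \<in> M" "monomial F c s = monomial F a s'" "s' + t = 0"
    by (rule factors_of_monomial) simp_all
  then show "s = 0"
    using c nonneg[of s'] nonneg[of t] by (auto simp: monomial_eq_iff)
next
  interpret A: comm_monoid A by (rule comm)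
  assume "s = 0"
  have c': "inv c \<in> carrier F - {\<zero>}" "c \<otimes> inv c = \<one>"
    using c field_Units by auto
  have "monomial F c 0 \<otimes>\<^bsub>A\<^esub> monomial F (inv c) 0 = \<one>\<^bsub>A\<^esub>"
    using c c' by (simp add: monomial_mult zero_mem one_A)
  moreover have "monomial F c 0 \<in> carrier A" "monomial F (inv c) 0 \<in> carrier A"
    using c c' by (simp_all add: monomial_closed zero_mem)
  ultimately show "monomial F c s \<in> Units A"
    unfolding \<open>s = 0\<close> Units_def
    using A.m_comm[of "monomial F c 0" "monomial F (inv c) 0"] by fastforce
qed

section \<open>Two ring conditions that force a single generator\<close>

lemma exists_positive:
  assumes "M \<noteq> {0}"
  obtains m where "m \<in> M" "m > 0"
proof -
  obtain m where "m \<in> M" "m \<noteq> 0" using assms zero_mem by auto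
  then show thesis using that[of m] nonneg[of m] by simp
qed

text \<open>
  The number \<open>l(m)\<close> of irreducible factors of \<open>X^m\<close> is well defined and additive in \<open>m\<close>. Since any
  two positive rationals have a common multiple, additivity makes \<open>l(m)\<close> proportional to \<open>m\<close>. An
  irreducible divisor of some \<open>X^a\<close> is a scalar multiple of a monomial \<open>X^s\<close> with \<open>l(s) = 1\<close>, which
  fixes the factor of proportionality: every \<open>m\<close> equals \<open>l(m) s\<close>.
\<close>

lemma half_factorial_imp_single_generator:
  assumes hfd: "half_factorial_domain A" and "M \<noteq> {0}"
  obtains s where "s \<in> M" "s > 0" "\<And>m. m \<in> M \<Longrightarrow> \<exists>n. m = of_nat n * s"
proof -
  interpret A: half_factorial_domain A by (rule hfd)
  let ?G = "mult_of A"
  have comm: "comm_monoid A" by (rule A.comm_monoid_axioms)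
  \<comment> \<open>\<open>L a n\<close> is the graph of the length function; as a relation it also covers
      the unit \<open>X^0\<close>, with length 0.\<close>
  define L where "L a n \<longleftrightarrow> (\<exists>fs. set fs \<subseteq> carrier ?G \<and> factors ?G fs (Xpow a) \<and> length fs = n)" for a n
  have Xpow_nonzero: "Xpow a \<in> carrier A - {\<zero>\<^bsub>A\<^esub>}" if "a \<in> M" for a
    using that by (simp add: monomial_closed monomial_nonzero)
  have Xpow_unit: "Xpow a \<in> Units A \<longleftrightarrow> a = 0" if "a \<in> M" for a
    using that comm by (simp add: monomial_Units_iff)
  have nonunit: "Xpow a \<in> carrier A - {\<zero>\<^bsub>A\<^esub>}" "Xpow a \<notin> Units A" if "a \<in> M" "a > 0" for a
    using Xpow_nonzero Xpow_unit that by auto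
  have L_ex: "\<exists>n. L a n" if "a \<in> M" "a > 0" for a
    using A.factorization_exists[OF nonunit[OF that]] unfolding L_def by blast
  have L_unique: "n = n'" if "L a n" "L a n'" "a \<in> M" "a > 0" for a n n'
    using A.factorization_length_unique[OF nonunit[OF that(3,4)]] that(1,2) unfolding L_def by blast
  have L_add: "L (a + b) (n + n')" if "L a n" "L b n'" "a \<in> M" "b \<in> M" for a b n n'
  proof -
    obtain fs gs where "set fs \<subseteq> carrier ?G" "factors ?G fs (Xpow a)" "length fs = n"
        "set gs \<subseteq> carrier ?G" "factors ?G gs (Xpow b)" "length gs = n'"
      using \<open>L a n\<close> \<open>L b n'\<close> unfolding L_def by blast
    then show ?thesis
      unfolding L_def using A.mult_of.factors_mult[of fs "Xpow a" gs "Xpow b"] Xpow_add[of a b] that(3,4)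
      by (intro exI[of _ "fs @ gs"]) auto
  qed
  have L_mult: "L (of_nat k * a) (k * n)" if "L a n" "a \<in> M" for a n k
  proof (induction k)
    case 0
    then show ?case by (simp add: L_def factors_def one_A)
  next
    case (Suc k)
    from L_add[OF that(1) this that(2) of_nat_mult_mem[OF that(2)]]
    show ?case by (simp add: algebra_simps)
  qed
  obtain a where a: "a \<in> M" "a > 0" using exists_positive[OF \<open>M \<noteq> {0}\<close>] .
  obtain fs where fs: "set fs \<subseteq> carrier ?G" "factors ?G fs (Xpow a)"
    using L_ex[OF a] by (auto simp: L_def)
  then have "fs \<noteq> []"
    using a by (auto simp: factors_def one_A monomial_eq_iff)
  then obtain f fs' where "fs = f # fs'" by (cases fs) auto
  then have f: "f \<in> carrier ?G" "irreducible ?G f"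
      and rest: "set fs' \<subseteq> carrier ?G" "f \<otimes>\<^bsub>A\<^esub> foldr (\<otimes>\<^bsub>A\<^esub>) fs' \<one>\<^bsub>A\<^esub> = Xpow a"
    using fs by (auto simp: factors_def)
  have "f \<in> carrier A" "foldr (\<otimes>\<^bsub>A\<^esub>) fs' \<one>\<^bsub>A\<^esub> \<in> carrier A"
    using f(1) A.mult_of.multlist_closed[OF rest(1)] by simp_all
  from this rest(2) one_not_zero
  obtain c s where cs: "c \<in> carrier F - {\<zero>}" "s \<in> M" "f = monomial F c s"
    by (rule factors_of_monomial) (use that in blast)
  have "s \<noteq> 0"
    using f(2) cs comm by (auto simp: irreducible_def monomial_Units_iff)
  then have "s > 0" using nonneg[OF cs(2)] by simp
  \<comment> \<open>Removing the scalar keeps the factor irreducible, because constants are units.\<close>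
  have c': "inv c \<in> carrier F - {\<zero>}" "c \<otimes> inv c = \<one>"
    using cs(1) field_Units by auto
  have "Xpow s = f \<otimes>\<^bsub>A\<^esub> monomial F (inv c) 0"
    using cs c' by (simp add: monomial_mult zero_mem)
  moreover have "monomial F (inv c) 0 \<in> Units ?G"
    using c' comm by (simp add: monomial_Units_iff zero_mem)
  ultimately have "irreducible ?G (Xpow s)"
    using f A.mult_of.irreducible_prod_rI[of f "monomial F (inv c) 0"]
      A.mult_of.Units_closed by simp
  then have "L s 1"
    unfolding L_def factors_def using Xpow_nonzero[OF cs(2)] by (intro exI[of _ "[Xpow s]"]) auto
  have "\<exists>n. m = of_nat n * s" if m: "m \<in> M" for m
  proof (cases "m = 0")
    case True
    then show ?thesis by (intro exI[of _ 0]) simp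
  next
    case False
    then have "m > 0" using nonneg[OF m] by simp
    then obtain n where n: "L m n" using L_ex[OF m] by blast
    obtain p q :: nat where pq: "p > 0" "q > 0" "of_nat p * m = of_nat q * s"
      using positive_rats_commensurable[OF \<open>m > 0\<close> \<open>s > 0\<close>] by blast
    have "L (of_nat p * m) (p * n)" "L (of_nat p * m) (q * 1)"
      using L_mult[OF n m, of p] L_mult[OF \<open>L s 1\<close> cs(2), of q] unfolding pq(3) by blast+
    then have "q = p * n"
      using L_unique[OF _ _ of_nat_mult_mem[OF m]] pq(1) \<open>m > 0\<close> by fastforce
    then have "m = of_nat n * s"
      using pq(1,3) by simp
    then show ?thesis by blast
  qed
  then show thesis using that cs(2) \<open>s > 0\<close> by blast
qed

text \<open>
  Some positive multiple \<open>p (s - t)\<close> is a multiple \<open>q t\<close> of \<open>t\<close>, hence lies in the monoid. So the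
  \<open>p\<close>-th power of \<open>X^s / X^t\<close> belongs to the algebra, therefore the quotient itself does, and it must
  be a monomial with exponent \<open>s - t\<close>.
\<close>

lemma integrally_closed_imp_diff_mem:
  assumes dom: "domain A" and ic: "integrally_closed A" and s: "s \<in> M" and t: "t \<in> M" and "t \<le> s"
  shows "s - t \<in> M"
proof (cases "t = 0 \<or> t = s")
  case True
  then show ?thesis using s zero_mem by auto
next
  case False
  interpret A: "domain" A by (rule dom)
  have "t > 0" "s - t > 0" using False nonneg[OF t] \<open>t \<le> s\<close> by auto
  then obtain p q :: nat where pq: "p > 0" "q > 0" "of_nat p * (s - t) = of_nat q * t"
    by (metis positive_rats_commensurable)
  then have "of_nat p * s = of_nat q * t + of_nat p * t"
    by (simp add: algebra_simps)
  then have "Xpow s [^]\<^bsub>A\<^esub> p = Xpow (of_nat q * t) \<otimes>\<^bsub>A\<^esub> Xpow t [^]\<^bsub>A\<^esub> p"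
    using Xpow_add[of "of_nat q * t" "of_nat p * t"] s t
    by (simp add: Xpow_of_nat_mult[symmetric] of_nat_mult_mem)
  from _ _ _ pq(1) this have "Xpow t divides\<^bsub>A\<^esub> Xpow s"
  proof (rule A.integrally_closed_root_divides[OF ic])
    show "Xpow s \<in> carrier A" "Xpow (of_nat q * t) \<in> carrier A"
      "Xpow t \<in> carrier A - {\<zero>\<^bsub>A\<^esub>}"
      using s t by (simp_all add: monomial_closed monomial_nonzero of_nat_mult_mem)
  qed
  then obtain g where g: "g \<in> carrier A" "Xpow t \<otimes>\<^bsub>A\<^esub> g = Xpow s"
    by (auto simp: factor_def)
  have "Xpow t \<in> carrier A"
    using t by (simp add: monomial_closed)
  from this g one_not_zero
  obtain a t' u where "Xpow t = monomial F a t'" "u \<in> M" "t' + u = s"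
    by (rule factors_of_monomial) (use that in blast)
  then show ?thesis by (auto simp: monomial_eq_iff)
qed

text \<open>
  In a noetherian domain some \<open>X^a\<close> has an irreducible divisor, a monomial with exponent \<open>s\<close>. A
  smaller positive exponent \<open>r\<close> would give the proper factorization \<open>X^r X^(s-r)\<close>, since the monoid
  contains differences of its elements when they are nonnegative. Hence \<open>s\<close> is its least positive element, and division with remainder by \<open>s\<close>
  stays inside the monoid, so that all remainders are zero.
\<close>

lemma noetherian_integrally_closed_imp_single_generator:
  assumes noeth: "noetherian_domain A" and ic: "integrally_closed A" and "M \<noteq> {0}"
  obtains s where "s \<in> M" "s > 0" "\<And>m. m \<in> M \<Longrightarrow> \<exists>n. m = of_nat n * s"
proof -
  interpret A: noetherian_domain A by (rule noeth)
  have comm: "comm_monoid A" by (rule A.comm_monoid_axioms)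
  note diff = integrally_closed_imp_diff_mem[OF A.domain_axioms ic]
  obtain a where a: "a \<in> M" "a > 0" using exists_positive[OF \<open>M \<noteq> {0}\<close>] .
  have "Xpow a \<in> carrier A - {\<zero>\<^bsub>A\<^esub>}" "Xpow a \<notin> Units A"
    using a comm by (simp_all add: monomial_closed monomial_nonzero monomial_Units_iff)
  then obtain f where f: "f \<in> carrier A" "ring_irreducible\<^bsub>A\<^esub> f" "f divides\<^bsub>A\<^esub> Xpow a"
    by (rule A.exists_irreducible_divisor)
  then obtain g where g: "g \<in> carrier A" "f \<otimes>\<^bsub>A\<^esub> g = Xpow a"
    by (auto simp: factor_def)
  from f(1) g one_not_zero
  obtain c s where cs: "c \<in> carrier F - {\<zero>}" "s \<in> M" "f = monomial F c s"
    by (rule factors_of_monomial) (use that in blast)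
  have "s \<noteq> 0"
    using A.ring_irreducibleE(4)[OF f(1,2)] cs comm by (auto simp: monomial_Units_iff)
  then have "s > 0" using nonneg[OF cs(2)] by simp
  have min: "r = 0" if r: "r \<in> M" "r < s" for r
  proof -
    have d: "s - r \<in> M" using diff[OF cs(2) r(1)] r(2) by simp
    have "f = Xpow r \<otimes>\<^bsub>A\<^esub> monomial F c (s - r)"
      using cs d r by (simp add: monomial_mult)
    then have "Xpow r \<in> Units A \<or> monomial F c (s - r) \<in> Units A"
      using A.ring_irreducibleE(5)[OF f(1,2)] cs r(1) d by (simp add: monomial_closed)
    then show "r = 0"
      using cs r d comm by (auto simp: monomial_Units_iff)
  qed
  have "\<exists>n. m = of_nat n * s" if m: "m \<in> M" for m
  proof -
    define n where "n = nat \<lfloor>m / s\<rfloor>"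
    have "0 \<le> \<lfloor>m / s\<rfloor>"
      using nonneg[OF m] \<open>s > 0\<close> by simp
    then have n: "of_nat n = (of_int \<lfloor>m / s\<rfloor> :: rat)" by (simp add: n_def)
    have le: "of_nat n * s \<le> m" "m - of_nat n * s < s"
      unfolding n using \<open>s > 0\<close> floor_divide_lower[of s m] floor_divide_upper[of s m]
      by (simp_all add: algebra_simps)
    then have "m - of_nat n * s = 0"
      using min diff[OF m of_nat_mult_mem[OF cs(2)]] by blast
    then show ?thesis by (intro exI[of _ n]) simp
  qed
  then show thesis using that cs(2) \<open>s > 0\<close> by blast
qed

end

section \<open>The equivalence\<close>

theorem theorem4p4:
  fixes F :: "('f, 'b) ring_scheme" and M :: "rat set"
  assumes "field F" and "puiseux_monoid M" and "M \<noteq> {0}"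
  shows "((\<exists>\<phi>. euclidean_domain (monoid_algebra F (monoid_of M)) \<phi>)
           \<longleftrightarrow> principal_domain (monoid_algebra F (monoid_of M))) \<and>
         (principal_domain (monoid_algebra F (monoid_of M))
           \<longleftrightarrow> factorial_domain (monoid_algebra F (monoid_of M))) \<and>
         (factorial_domain (monoid_algebra F (monoid_of M))
           \<longleftrightarrow> half_factorial_domain (monoid_algebra F (monoid_of M))) \<and>
         (half_factorial_domain (monoid_algebra F (monoid_of M))
           \<longleftrightarrow> monoid_of M \<cong> nat_add_monoid) \<and>
         (monoid_of M \<cong> nat_add_monoid
           \<longleftrightarrow> dedekind_domain (monoid_algebra F (monoid_of M)))"
proof -
  interpret puiseux_algebra F M
    using assms by (simp add: puiseux_algebra_def puiseux_algebra_axioms_def)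
  have 12: "principal_domain A" if "euclidean_domain A \<phi>" for \<phi>
  proof -
    interpret E: euclidean_domain A \<phi> by (rule that)
    show ?thesis by (rule E.principal_domain_axioms)
  qed
  have 23: "factorial_domain A" if "principal_domain A"
  proof -
    interpret P: principal_domain A by (rule that)
    show ?thesis by (rule P.factorial_domain_axioms)
  qed
  have 34: "half_factorial_domain A" if "factorial_domain A"
    using that by (rule factorial_domain.half_factorial)
  have 45: "monoid_of M \<cong> nat_add_monoid" if "half_factorial_domain A"
    using half_factorial_imp_single_generator[OF that \<open>M \<noteq> {0}\<close>]
      submultiples_iso_nat[OF \<open>puiseux_monoid M\<close>] by metis
  have 51: "\<exists>\<phi>. euclidean_domain A \<phi>" if "monoid_of M \<cong> nat_add_monoid"
    using monoid_monoid_of that by (rule monoid_algebra_euclidean)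
  have 26: "dedekind_domain A" if "principal_domain A"
    using that by (rule principal_domain.dedekind)
  have 65: "monoid_of M \<cong> nat_add_monoid" if "dedekind_domain A"
  proof -
    interpret D: dedekind_domain A by (rule that)
    show ?thesis
      using noetherian_integrally_closed_imp_single_generator
          [OF D.noetherian_domain_axioms D.integrally_closed \<open>M \<noteq> {0}\<close>]
        submultiples_iso_nat[OF \<open>puiseux_monoid M\<close>] by metis
  qed
  show ?thesis
    using 12 23 34 45 51 26 65 by blast
qed

end
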